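(* As polynomials in $x$ and $y$ with coefficients in the group algebra of $\mathfrak{B}_n$, $$\phi_A(x/2)\,\psi(y/2)=\phi_A(xy/2)$$ and $$\psi(x/2)\,\phi_A(y/2)=\psi(xy/2).$$
   Context: Let $n\ge 1$. The hyperoctahedral group $\mathfrak{B}_n$ is the group (under composition of functions, $(\sigma\tau)(i)=\sigma(\tau(i))$) of all bijections $\pi$ of $\{-n,\ldots,-1,0,1,\ldots,n\}$ with $\pi(-i)=-\pi(i)$ for all $i$. For $\pi\in\mathfrak{B}_n$, $\mathrm{des}_A(\pi)=|\{i\in\{1,\ldots,n-1\}:\pi(i)>\pi(i+1)\}|$, and $\mathrm{ades}(\pi)$ is the number of $i\in\{0,1,\ldots,n\}$ with $\pi(i)>\pi(i+1)$, where $\pi(0)=0$ and $\pi(n+1):=0$. Define $$\phi_A(x)=\sum_{\pi\in\mathfrak{B}_n}\binom{x+n-1-\mathrm{des}_A(\pi)}{n}\pi,\qquad \psi(x)=\sum_{\pi\in\mathfrak{B}_n}\binom{x+n-\mathrm{ades}(\pi)}{n}\pi,$$ polynomials in $x$ with coefficients in $\mathbb{Q}[\mathfrak{B}_n]$, where $\binom{z}{n}=z(z-1)\cdots(z-n+1)/n!$. *)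

theory Defs
  imports
    "HOL-Library.Poly_Mapping"
    "HOL-Combinatorics.Permutations"
    "HOL-Computational_Algebra.Polynomial"
begin

text \<open>
  The elements of all hyperoctahedral groups live in one type: an element of the \<open>n\<close>-th group
  is extended from \<open>{-n..n}\<close> to the integers by the identity. The group operation is written
  additively, since this is the form in which the convolution product of
  \<^theory>\<open>HOL-Library.Poly_Mapping\<close> expects it: \<open>\<sigma> + \<tau>\<close> is the composition \<open>i \<mapsto> \<sigma> (\<tau> i)\<close>,
  which is not commutative.
\<close>

typedef signed_perm = "{f :: int \<Rightarrow> int. bij f \<and> (\<forall>i. f (- i) = - f i)}"
  morphisms sapply Abs_signed_perm
  by (rule exI[of _ id]) simp

setup_lifting type_definition_signed_perm

lemma odd_inv:
  fixes f :: "int \<Rightarrow> int"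
  assumes "bij f" "\<forall>i. f (- i) = - f i"
  shows "inv f (- i) = - inv f i"
  using assms by (metis bij_inv_eq_iff)

instantiation signed_perm :: group_add
begin

lift_definition zero_signed_perm :: signed_perm is id by simp

lift_definition plus_signed_perm :: "signed_perm \<Rightarrow> signed_perm \<Rightarrow> signed_perm" is "(\<circ>)"
  by (simp add: bij_comp)

lift_definition uminus_signed_perm :: "signed_perm \<Rightarrow> signed_perm" is inv
  by (simp add: bij_imp_bij_inv odd_inv)

lift_definition minus_signed_perm :: "signed_perm \<Rightarrow> signed_perm \<Rightarrow> signed_perm"
  is "\<lambda>f g. f \<circ> inv g"
  by (simp add: bij_comp bij_imp_bij_inv odd_inv)

instance
  by standard (transfer; simp add: comp_assoc bij_is_inj inv_o_cancel; fail)+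

end

definition hyperoctahedral :: "nat \<Rightarrow> signed_perm set" where
  "hyperoctahedral n = {\<pi>. sapply \<pi> permutes {- int n..int n}}"

lemma finite_hyperoctahedral: "finite (hyperoctahedral n)"
proof -
  have "finite (sapply ` hyperoctahedral n)"
    by (rule finite_subset[OF _ finite_permutations[of "{- int n..int n}"]])
      (auto simp: hyperoctahedral_def)
  then show ?thesis
    by (rule finite_imageD) (simp add: inj_on_def sapply_inject)
qed

definition des_A :: "nat \<Rightarrow> signed_perm \<Rightarrow> nat" where
  "des_A n \<pi> = card {i \<in> {1..int n - 1}. sapply \<pi> i > sapply \<pi> (i + 1)}"

text \<open>
  Only the convention \<open>\<pi> (n + 1) = 0\<close> has to be imposed in \<open>ades\<close>: \<open>\<pi> 0 = 0\<close> holds because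
  \<open>\<pi>\<close> is odd.
\<close>

definition ades :: "nat \<Rightarrow> signed_perm \<Rightarrow> nat" where
  "ades n \<pi> =
     card {i \<in> {0..int n}. sapply \<pi> i > (if i = int n then 0 else sapply \<pi> (i + 1))}"

lemma sapply_0 [simp]: "sapply \<pi> 0 = 0"
  using sapply[of \<pi>] by (auto dest: spec[of _ 0])

text \<open>
  Polynomials in \<open>x\<close> and \<open>y\<close> with coefficients in the group algebra over the rationals are
  represented as elements of the group algebra with coefficients in the ring of rational
  polynomials in \<open>x\<close> and \<open>y\<close>, i.e. the scalar coefficient of \<open>x\<^sup>i y\<^sup>j \<pi>\<close> is looked up
  first by \<open>\<pi>\<close> and then by \<open>j\<close> and \<open>i\<close>. The variable \<open>x\<close> is the one of the inner
  polynomial type.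
\<close>

type_synonym group_algebra_xy = "signed_perm \<Rightarrow>\<^sub>0 rat poly poly"

definition var_x :: "rat poly poly" where "var_x = [:[:0, 1:]:]"
definition var_y :: "rat poly poly" where "var_y = [:0, 1:]"
definition half :: "rat poly poly" where "half = [:[:1/2:]:]"

text \<open>
  The generalised binomial coefficient \<open>z (z - 1) \<dots> (z - k + 1) / k!\<close>; the library's
  \<^const>\<open>gbinomial\<close> is only available over fields.
\<close>

definition binom_poly :: "rat poly poly \<Rightarrow> nat \<Rightarrow> rat poly poly" where
  "binom_poly z k = smult [:1 / fact k:] (\<Prod>i<k. z - of_nat i)"

text \<open>
  The polynomials \<open>\<phi>\<^sub>A\<close> and \<open>\<psi>\<close>, with a polynomial \<open>z\<close> substituted for their variable.
\<close>

definition phi_A :: "nat \<Rightarrow> rat poly poly \<Rightarrow> group_algebra_xy" where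
  "phi_A n z = (\<Sum>\<pi>\<in>hyperoctahedral n.
     Poly_Mapping.single \<pi> (binom_poly (z + of_nat n - 1 - of_nat (des_A n \<pi>)) n))"

definition psi :: "nat \<Rightarrow> rat poly poly \<Rightarrow> group_algebra_xy" where
  "psi n z = (\<Sum>\<pi>\<in>hyperoctahedral n.
     Poly_Mapping.single \<pi> (binom_poly (z + of_nat n - of_nat (ades n \<pi>)) n))"

end

theory Submission
  imports Defs "HOL-Library.FuncSet"
begin

text \<open>
  Both products are instances of one counting identity. Colour the letters \<open>1..n\<close> by integers of
  a fixed parity in \<open>[-2a, 2a)\<close>, extend the colouring to an odd function \<open>F\<close> on \<open>{-n..n}\<close>, and let its
  standardization be the signed permutation \<open>\<sigma>\<close> that lists the signed letters in increasing order of
  \<open>(F j, j)\<close>. By the usual count of \<open>P\<close>-partitions, the number of colourings with standardization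
  \<open>\<pi>\<close> is the coefficient of \<open>\<pi>\<close> in \<open>\<phi>\<^sub>A(a)\<close> for odd colours and in \<open>\<psi>(a)\<close> for even ones. Given \<open>F\<close> with
  standardization \<open>\<sigma>\<close> and bound \<open>2a\<close>, and \<open>G\<close> with standardization \<open>\<tau>\<close> and bound \<open>2b\<close>, the colouring
  \<open>H j = 2a G(\<sigma>\<inverse> j) + F j\<close> has the parity of \<open>F\<close>, the bound \<open>4ab\<close> and standardization \<open>\<sigma>\<tau>\<close>. The map
  \<open>(F, G) \<mapsto> H\<close> is injective, because \<open>F\<close> can be read off modulo \<open>4a\<close>, hence bijective since
  \<open>(2a)^n (2b)^n = (4ab)^n\<close>. This proves the formula at \<open>x = 2a\<close>, \<open>y = 2b\<close> for all positive
  integers, which suffices.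
\<close>

section \<open>Sorting with respect to an odd key\<close>

lemma sapply_minus [simp]: "sapply \<pi> (- i) = - sapply \<pi> i"
  using sapply[of \<pi>] by auto

lemma sapply_plus [simp]: "sapply (\<sigma> + \<tau>) i = sapply \<sigma> (sapply \<tau> i)"
  by (simp add: plus_signed_perm.rep_eq)

lemma hyperoctahedral_permutes:
  "\<pi> \<in> hyperoctahedral n \<Longrightarrow> sapply \<pi> permutes {- int n..int n}"
  by (simp add: hyperoctahedral_def)

lemma sapply_range:
  "\<pi> \<in> hyperoctahedral n \<Longrightarrow> sapply \<pi> i \<in> {- int n..int n} \<longleftrightarrow> i \<in> {- int n..int n}"
  by (rule permutes_in_image[OF hyperoctahedral_permutes])

lemma sapply_eq_iff [simp]: "sapply \<pi> i = sapply \<pi> j \<longleftrightarrow> i = j"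
  using sapply[of \<pi>] by (auto simp: bij_def inj_eq)

lemma sapply_eq_0_iff [simp]: "sapply \<pi> i = 0 \<longleftrightarrow> i = 0"
  using sapply_eq_iff[of \<pi> i 0] by simp

lemma sapply_uminus_cancel [simp]:
  "sapply (- \<pi>) (sapply \<pi> i) = i" "sapply \<pi> (sapply (- \<pi>) i) = i"
  using sapply_plus[of "- \<pi>" \<pi> i] sapply_plus[of \<pi> "- \<pi>" i]
  by (simp_all add: zero_signed_perm.rep_eq)

lemma hyperoctahedral_plus:
  "\<sigma> \<in> hyperoctahedral n \<Longrightarrow> \<tau> \<in> hyperoctahedral n \<Longrightarrow> \<sigma> + \<tau> \<in> hyperoctahedral n"
  by (simp add: hyperoctahedral_def plus_signed_perm.rep_eq permutes_compose)

lemma hyperoctahedral_uminus: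
  "\<sigma> \<in> hyperoctahedral n \<Longrightarrow> - \<sigma> \<in> hyperoctahedral n"
  by (simp add: hyperoctahedral_def uminus_signed_perm.rep_eq permutes_inv)

lemma hyperoctahedral_eqI:
  assumes "\<sigma> \<in> hyperoctahedral n" "\<tau> \<in> hyperoctahedral n"
    and "\<And>i. i \<in> {- int n..int n} \<Longrightarrow> sapply \<sigma> i = sapply \<tau> i"
  shows "\<sigma> = \<tau>"
proof -
  have "sapply \<sigma> i = sapply \<tau> i" for i
    using assms(3) permutes_not_in[OF hyperoctahedral_permutes[OF assms(1)]]
      permutes_not_in[OF hyperoctahedral_permutes[OF assms(2)]]
    by (cases "i \<in> {- int n..int n}") simp_all
  then show ?thesis by (simp add: sapply_inject[symmetric] fun_eq_iff)
qed

text \<open>The shift by \<open>n\<close> centres the ranks of the \<open>2n + 1\<close> letters at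
  \<open>0\<close>. For an odd injective key, \<open>rank n K\<close> is the inverse of the sorting
  permutation on \<open>{-n..n}\<close>.\<close>

definition rank :: "nat \<Rightarrow> (int \<Rightarrow> int) \<Rightarrow> int \<Rightarrow> int" where
  "rank n K j = int (card {i \<in> {- int n..int n}. K i < K j}) - int n"

lemma rank_less:
  assumes "i \<in> {- int n..int n}" "K i < K j"
  shows "rank n K i < rank n K j"
proof -
  have "{i' \<in> {- int n..int n}. K i' < K i} \<subset> {i' \<in> {- int n..int n}. K i' < K j}"
    using assms by auto
  then have "card {i' \<in> {- int n..int n}. K i' < K i} < card {i' \<in> {- int n..int n}. K i' < K j}"
    by (rule psubset_card_mono[rotated]) (rule finite_subset[of _ "{- int n..int n}"], auto)
  then show ?thesis by (simp add: rank_def)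
qed

text \<open>Negation carries the letters with key above that of \<open>j\<close> onto those with key
  below that of \<open>- j\<close>. The letters above \<open>j\<close>, those below it and
  \<open>j\<close> itself are \<open>2n + 1\<close> in number, so the two shifted ranks
  cancel.\<close>

lemma rank_uminus:
  assumes odd: "\<And>i. K (- i) = - K i" and inj: "inj_on K {- int n..int n}"
    and j: "j \<in> {- int n..int n}"
  shows "rank n K (- j) = - rank n K j"
proof -
  let ?I = "{- int n..int n}"
  have "{i \<in> ?I. K i < K (- j)} = uminus ` {i \<in> ?I. K j < K i}"
  proof (intro equalityI subsetI)
    fix i assume "i \<in> {i \<in> ?I. K i < K (- j)}"
    then show "i \<in> uminus ` {i \<in> ?I. K j < K i}"
      by (intro image_eqI[of _ _ "- i"]) (auto simp: odd)
  qed (auto simp: odd)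
  then have "card {i \<in> ?I. K i < K (- j)} = card (uminus ` {i \<in> ?I. K j < K i})"
    by simp
  also have "\<dots> = card {i \<in> ?I. K j < K i}" by (rule card_image) (simp add: inj_on_def)
  finally have 1: "card {i \<in> ?I. K i < K (- j)} = card {i \<in> ?I. K j < K i}" .
  have "?I = {i \<in> ?I. K i < K j} \<union> {i \<in> ?I. K j < K i} \<union> {j}"
  proof (intro equalityI subsetI)
    fix i assume i: "i \<in> ?I"
    have "K i \<noteq> K j \<or> i = j" using inj_onD[OF inj _ i j] by blast
    with i show "i \<in> {i \<in> ?I. K i < K j} \<union> {i \<in> ?I. K j < K i} \<union> {j}" by auto
  qed (use j in auto)
  then have "card ?I = card ({i \<in> ?I. K i < K j} \<union> {i \<in> ?I. K j < K i} \<union> {j})"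
    by (rule arg_cong)
  also have "\<dots> = card {i \<in> ?I. K i < K j} + card {i \<in> ?I. K j < K i} + 1"
  proof -
    have fin: "finite {i \<in> ?I. P i}" for P by (rule finite_subset[of _ ?I]) auto
    have "card {i \<in> ?I. K i < K j} + card {i \<in> ?I. K j < K i}
        = card ({i \<in> ?I. K i < K j} \<union> {i \<in> ?I. K j < K i})"
      by (rule card_Un_disjoint[symmetric]) (use fin in auto)
    moreover have "card ({i \<in> ?I. K i < K j} \<union> {i \<in> ?I. K j < K i} \<union> {j})
        = card ({i \<in> ?I. K i < K j} \<union> {i \<in> ?I. K j < K i}) + card {j}"
      by (rule card_Un_disjoint) (use fin in auto)
    ultimately show ?thesis by simp
  qed
  finally show ?thesis using 1 by (simp add: rank_def)
qed

lemma rank_range: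
  assumes "inj_on K {- int n..int n}" "j \<in> {- int n..int n}"
  shows "rank n K j \<in> {- int n..int n}"
proof -
  let ?I = "{- int n..int n}"
  have "card {i \<in> ?I. K i < K j} < card ?I"
  proof (rule psubset_card_mono)
    show "{i \<in> ?I. K i < K j} \<subset> ?I" using assms(2) by blast
  qed simp
  then show ?thesis by (simp add: rank_def)
qed

definition sorts :: "nat \<Rightarrow> (int \<Rightarrow> int) \<Rightarrow> signed_perm \<Rightarrow> bool" where
  "sorts n K \<sigma> \<longleftrightarrow> \<sigma> \<in> hyperoctahedral n \<and> strict_mono_on {- int n..int n} (\<lambda>k. K (sapply \<sigma> k))"

text \<open>A sorting permutation matches the positions below \<open>k\<close> with the letters of
  smaller key, so there are \<open>k + n\<close> of the latter. Its inverse is thus forced to be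
  \<open>rank\<close>, which yields uniqueness.\<close>

lemma sorts_imp_rank:
  assumes "sorts n K \<sigma>" "k \<in> {- int n..int n}"
  shows "rank n K (sapply \<sigma> k) = k"
proof -
  let ?I = "{- int n..int n}"
  have \<sigma>: "\<sigma> \<in> hyperoctahedral n" and m: "strict_mono_on ?I (\<lambda>k. K (sapply \<sigma> k))"
    using assms(1) by (auto simp: sorts_def)
  have "{i \<in> ?I. K i < K (sapply \<sigma> k)} = sapply \<sigma> ` {l \<in> ?I. l < k}"
  proof (intro equalityI subsetI)
    fix i assume i: "i \<in> {i \<in> ?I. K i < K (sapply \<sigma> k)}"
    then have l: "sapply (- \<sigma>) i \<in> ?I"
      using sapply_range[OF hyperoctahedral_uminus[OF \<sigma>], of i] by auto
    have "sapply (- \<sigma>) i < k"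
      using i strict_mono_on_less[OF m l assms(2)] by simp
    with l show "i \<in> sapply \<sigma> ` {l \<in> ?I. l < k}"
      by (intro image_eqI[of _ _ "sapply (- \<sigma>) i"]) auto
  next
    fix i assume "i \<in> sapply \<sigma> ` {l \<in> ?I. l < k}"
    then obtain l where "l \<in> ?I" "l < k" "i = sapply \<sigma> l" by auto
    then show "i \<in> {i \<in> ?I. K i < K (sapply \<sigma> k)}"
      using strict_mono_onD[OF m \<open>l \<in> ?I\<close> assms(2)] sapply_range[OF \<sigma>, of l] by auto
  qed
  then have "card {i \<in> ?I. K i < K (sapply \<sigma> k)} = card {l \<in> ?I. l < k}"
    by (simp add: card_image inj_on_def)
  also have "{l \<in> ?I. l < k} = {- int n..<k}" using assms(2) by auto
  finally show ?thesis using assms(2) by (simp add: rank_def)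
qed

lemma sorts_unique:
  assumes "sorts n K \<sigma>" "sorts n K \<tau>"
  shows "\<sigma> = \<tau>"
proof -
  have \<sigma>: "\<sigma> \<in> hyperoctahedral n" and \<tau>: "\<tau> \<in> hyperoctahedral n"
    using assms by (auto simp: sorts_def)
  have "sapply (- \<sigma>) i = sapply (- \<tau>) i" if i: "i \<in> {- int n..int n}" for i
    using sorts_imp_rank[OF assms(1), of "sapply (- \<sigma>) i"] sorts_imp_rank[OF assms(2), of "sapply (- \<tau>) i"]
      sapply_range[OF hyperoctahedral_uminus[OF \<sigma>], of i] sapply_range[OF hyperoctahedral_uminus[OF \<tau>], of i] i
    by simp
  then have "- \<sigma> = - \<tau>"
    by (rule hyperoctahedral_eqI[OF hyperoctahedral_uminus[OF \<sigma>] hyperoctahedral_uminus[OF \<tau>]])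
  then show ?thesis by simp
qed

text \<open>Ranks are injective, hence permute the interval, and they are odd by
  \<open>rank_uminus\<close>; the inverse permutation sorts.\<close>

lemma sorts_exists:
  assumes odd: "\<And>i. K (- i) = - K i" and inj: "inj_on K {- int n..int n}"
  shows "\<exists>\<sigma>. sorts n K \<sigma>"
proof -
  let ?I = "{- int n..int n}"
  \<comment> \<open>Elements of \<open>hyperoctahedral n\<close> are the identity outside the
    interval, whereas \<open>rank\<close> is not.\<close>
  define r where "r j = (if j \<in> ?I then rank n K j else j)" for j
  have "inj_on r ?I"
  proof (rule inj_onI)
    fix i j assume *: "i \<in> ?I" "j \<in> ?I" "r i = r j"
    then have "\<not> K i < K j" "\<not> K j < K i"
      using rank_less[of i n K j] rank_less[of j n K i] by (auto simp: r_def)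
    then show "i = j" using * inj by (auto simp: inj_on_def)
  qed
  moreover have "r ` ?I \<subseteq> ?I"
  proof (rule image_subsetI)
    fix j assume "j \<in> ?I"
    then show "r j \<in> ?I" using rank_range[OF inj, of j] unfolding r_def by simp
  qed
  ultimately have "bij_betw r ?I ?I"
    using endo_inj_surj[of ?I r] by (simp add: bij_betw_def)
  then have perm: "r permutes ?I"
    by (rule bij_imp_permutes) (auto simp: r_def)
  have odd_r: "r (- i) = - r i" for i
    using rank_uminus[OF odd inj, of i] by (auto simp: r_def)
  define \<rho> where "\<rho> = Abs_signed_perm r"
  have \<rho>: "sapply \<rho> = r"
    unfolding \<rho>_def by (rule Abs_signed_perm_inverse) (use permutes_bij[OF perm] odd_r in simp)
  then have h: "\<rho> \<in> hyperoctahedral n" using perm by (simp add: hyperoctahedral_def)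
  have "K (sapply (- \<rho>) k) < K (sapply (- \<rho>) l)" if kl: "k \<in> ?I" "l \<in> ?I" "k < l" for k l
  proof (rule ccontr)
    let ?i = "sapply (- \<rho>) k" and ?j = "sapply (- \<rho>) l"
    assume *: "\<not> K ?i < K ?j"
    have ij: "?i \<in> ?I" "?j \<in> ?I"
      using kl sapply_range[OF hyperoctahedral_uminus[OF h]] by blast+
    have "?i \<noteq> ?j" using kl by simp
    then have "K ?j < K ?i" using * inj_onD[OF inj _ ij] by (meson linorder_neqE)
    then have "rank n K ?j < rank n K ?i" by (rule rank_less[OF ij(2)])
    moreover have "r ?i = k" "r ?j = l" unfolding \<rho>[symmetric] by simp_all
    ultimately show False using kl ij by (simp add: r_def)
  qed
  then have "strict_mono_on ?I (\<lambda>k. K (sapply (- \<rho>) k))" by (rule strict_mono_onI)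
  then have "sorts n K (- \<rho>)" using hyperoctahedral_uminus[OF h] by (simp add: sorts_def)
  then show ?thesis ..
qed

section \<open>Counting sequences with prescribed gaps\<close>

lemma strict_mono_on_int_intervalI:
  fixes G :: "int \<Rightarrow> int"
  assumes step: "\<And>k. a \<le> k \<Longrightarrow> k < b \<Longrightarrow> G k < G (k + 1)"
  shows "strict_mono_on {a..b} G"
proof (rule strict_mono_onI)
  fix k l assume kl: "k \<in> {a..b}" "l \<in> {a..b}" "k < l"
  from \<open>k < l\<close> have "l \<le> b \<longrightarrow> G k < G l"
  proof (induction rule: int_gr_induct)
    case base
    then show ?case using step[of k] kl by auto
  next
    case (step i)
    then show ?case using assms[of i] kl by force
  qed
  then show "G k < G l" using kl by auto
qed

text \<open>A strictly increasing map is determined by its image, which can be any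
  \<open>n\<close>-subset of \<open>{1..m}\<close>.\<close>

lemma card_strict_mono_functions:
  "card {u \<in> {1..int n} \<rightarrow>\<^sub>E {1..int m}. strict_mono_on {1..int n} u} = m choose n"
proof -
  let ?I = "{1..int n}" and ?J = "{1..int m}"
  let ?U = "{u \<in> ?I \<rightarrow>\<^sub>E ?J. strict_mono_on ?I u}"
  have list: "sorted_list_of_set (u ` ?I) = map u [1..int n]" if "strict_mono_on ?I u" for u :: "int \<Rightarrow> int"
  proof (rule strict_sorted_equal)
    show "sorted_wrt (<) (map u [1..int n])"
      unfolding sorted_wrt_map
    proof (rule sorted_wrt_mono_rel[OF _ sorted_wrt_upto])
      fix k l assume "k \<in> set [1..int n]" "l \<in> set [1..int n]" "k < l"
      then show "u k < u l" using strict_mono_onD[OF that, of k l] by simp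
    qed
    show "sorted_wrt (<) (sorted_list_of_set (u ` ?I))"
      by (rule strict_sorted_list_of_set)
  qed simp
  have "bij_betw (\<lambda>u. u ` ?I) ?U {B. B \<subseteq> ?J \<and> card B = n}"
  proof (rule bij_betw_imageI)
    show "inj_on (\<lambda>u. u ` ?I) ?U"
    proof (rule inj_onI)
      fix u v assume uv: "u \<in> ?U" "v \<in> ?U" "u ` ?I = v ` ?I"
      then have "strict_mono_on ?I u" "strict_mono_on ?I v" by blast+
      then have "map u [1..int n] = map v [1..int n]"
        by (simp only: list[symmetric] uv(3))
      then have eq: "u k = v k" if "k \<in> ?I" for k using that by (simp add: map_eq_conv)
      have "u \<in> ?I \<rightarrow>\<^sub>E ?J" "v \<in> ?I \<rightarrow>\<^sub>E ?J" using uv by blast+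
      then show "u = v" using eq by (rule PiE_ext)
    qed
    show "(\<lambda>u. u ` ?I) ` ?U = {B. B \<subseteq> ?J \<and> card B = n}"
    proof (intro equalityI subsetI)
      fix B assume "B \<in> (\<lambda>u. u ` ?I) ` ?U"
      then obtain u where u: "u \<in> ?U" "B = u ` ?I" by auto
      then have "inj_on u ?I" by (intro strict_mono_on_imp_inj_on) blast
      then have "card B = card ?I" unfolding u(2) by (rule card_image)
      moreover have "B \<subseteq> ?J" using u by blast
      ultimately show "B \<in> {B. B \<subseteq> ?J \<and> card B = n}" by simp
    next
      fix B assume B: "B \<in> {B. B \<subseteq> ?J \<and> card B = n}"
      then have fin: "finite B" using finite_subset[of B ?J] by auto
      define xs where "xs = sorted_list_of_set B"
      have xs: "sorted_wrt (<) xs" "set xs = B" "length xs = n"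
        using fin B by (auto simp: xs_def)
      define u where "u = (\<lambda>k\<in>?I. xs ! (nat k - 1))"
      have im: "u ` ?I = B"
      proof (intro equalityI subsetI)
        fix b assume "b \<in> u ` ?I"
        then obtain k where k: "k \<in> ?I" "b = xs ! (nat k - 1)" by (auto simp: u_def)
        then have "nat k - 1 < length xs" using xs by auto
        then show "b \<in> B" using k xs by auto
      next
        fix b assume "b \<in> B"
        then obtain i where "i < n" "b = xs ! i" using xs by (metis in_set_conv_nth)
        then show "b \<in> u ` ?I" by (intro image_eqI[of _ _ "int i + 1"]) (auto simp: u_def nat_add_distrib)
      qed
      have "strict_mono_on ?I u"
      proof (rule strict_mono_onI)
        fix k l assume "k \<in> ?I" "l \<in> ?I" "k < l"
        then show "u k < u l"
          using sorted_wrt_nth_less[OF xs(1), of "nat k - 1" "nat l - 1"] xs(3) by (auto simp: u_def)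
      qed
      moreover have "u \<in> ?I \<rightarrow>\<^sub>E ?J" using im B by (auto simp: u_def)
      ultimately show "B \<in> (\<lambda>u. u ` ?I) ` ?U" using im by blast
    qed
  qed
  then show ?thesis using n_subsets[of ?J n] by (simp add: bij_betw_same_card)
qed

text \<open>\<open>e 0\<close> and \<open>e (int n)\<close> act as gaps to the fixed ends
  \<open>0\<close> and \<open>h\<close>. Once all gaps are normalised, the strictly increasing
  sequences in \<open>{1..m}\<close> remain.\<close>

lemma card_gap_sequences:
  fixes e :: "int \<Rightarrow> int" and h :: int
  assumes n: "n \<ge> 1" and nonneg: "0 \<le> h + int n - (\<Sum>i\<in>{0..int n}. e i)"
  shows "card {t \<in> {1..int n} \<rightarrow>\<^sub>E UNIV. e 0 \<le> t 1 \<and> (\<forall>k\<in>{1..<int n}. t k + e k \<le> t (k + 1))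
      \<and> t (int n) + e (int n) \<le> h} = nat (h + int n - (\<Sum>i\<in>{0..int n}. e i)) choose n"
proof -
  let ?I = "{1..int n}"
  let ?T = "{t \<in> ?I \<rightarrow>\<^sub>E UNIV. e 0 \<le> t 1 \<and> (\<forall>k\<in>{1..<int n}. t k + e k \<le> t (k + 1))
      \<and> t (int n) + e (int n) \<le> h}"
  define m where "m = nat (h + int n - (\<Sum>i\<in>{0..int n}. e i))"
  define d where "d k = k - (\<Sum>i\<in>{0..<k}. e i)" for k
  let ?U = "{u \<in> ?I \<rightarrow>\<^sub>E {1..int m}. strict_mono_on ?I u}"
  have "{0..<k + 1} = insert k {0..<k}" if "0 \<le> k" for k :: int using that by auto
  then have d_step: "d (k + 1) = d k + 1 - e k" if "0 \<le> k" for k using that by (simp add: d_def)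
  have d1: "d 1 = 1 - e 0" using d_step[of 0] by (simp add: d_def)
  have "{0..int n} = insert (int n) {0..<int n}" by auto
  \<comment> \<open>With this \<open>m\<close>, the end condition on \<open>t (int n)\<close> says
    that the shifted value is at most \<open>m\<close>.\<close>
  then have m: "int m = h + d (int n) - e (int n)" using nonneg by (simp add: m_def d_def)
  \<comment> \<open>Adding \<open>d\<close> turns every prescribed gap into the gap \<open>1\<close>.\<close>
  have "bij_betw (\<lambda>t. \<lambda>k\<in>?I. t k + d k) ?T ?U"
  proof (rule bij_betw_byWitness[where f' = "\<lambda>u. \<lambda>k\<in>?I. u k - d k"])
    show "\<forall>t\<in>?T. (\<lambda>k\<in>?I. (\<lambda>k\<in>?I. t k + d k) k - d k) = t"
      by (auto intro!: ext simp: PiE_def extensional_def)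
    show "\<forall>u\<in>?U. (\<lambda>k\<in>?I. (\<lambda>k\<in>?I. u k - d k) k + d k) = u"
      by (auto intro!: ext simp: PiE_def extensional_def)
    show "(\<lambda>t. \<lambda>k\<in>?I. t k + d k) ` ?T \<subseteq> ?U"
    proof (rule image_subsetI)
      fix t assume t: "t \<in> ?T"
      define u where "u = (\<lambda>k\<in>?I. t k + d k)"
      have mono: "strict_mono_on ?I u"
        by (rule strict_mono_on_int_intervalI) (use t d_step in \<open>force simp: u_def\<close>)
      have "u k \<in> {1..int m}" if k: "k \<in> ?I" for k
      proof -
        have "u 1 \<le> u k" "u k \<le> u (int n)"
          using k n strict_mono_on_leD[OF mono, of 1 k] strict_mono_on_leD[OF mono, of k "int n"] by auto
        moreover have "1 \<le> u 1" "u (int n) \<le> int m" using t n d1 m by (auto simp: u_def)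
        ultimately show ?thesis by auto
      qed
      then have "u \<in> ?U" using mono by (auto simp: u_def)
      then show "(\<lambda>k\<in>?I. t k + d k) \<in> ?U" by (simp add: u_def)
    qed
    show "(\<lambda>u. \<lambda>k\<in>?I. u k - d k) ` ?U \<subseteq> ?T"
    proof (rule image_subsetI)
      fix u assume u: "u \<in> ?U"
      then have u1: "1 \<le> u 1" and un: "u (int n) \<le> int m"
        using n PiE_mem[of u ?I _ 1] PiE_mem[of u ?I _ "int n"]
        by auto
      have "u k - d k + e k \<le> u (k + 1) - d (k + 1)" if "k \<in> {1..<int n}" for k
        using that d_step[of k] u strict_mono_onD[of ?I u k "k + 1"] by auto
      then show "(\<lambda>k\<in>?I. u k - d k) \<in> ?T" using u1 un n d1 m by auto
    qed
  qed
  then show ?thesis using card_strict_mono_functions[of n m] by (simp add: bij_betw_same_card m_def)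
qed

section \<open>Colourings and their standardization\<close>

text \<open>The factor \<open>sgn j\<close> gives the letter \<open>0\<close> the colour
  \<open>0\<close>, whatever value \<open>f\<close> has there.\<close>

definition odd_ext :: "(int \<Rightarrow> int) \<Rightarrow> int \<Rightarrow> int" where
  "odd_ext f j = sgn j * f \<bar>j\<bar>"

lemma odd_ext_simps [simp]:
  "odd_ext f (- j) = - odd_ext f j"
  "odd_ext f 0 = 0"
  "0 < j \<Longrightarrow> odd_ext f j = f j"
  by (simp_all add: odd_ext_def sgn_minus)

lemma odd_ext_neg: "j < 0 \<Longrightarrow> odd_ext f j = - f (- j)"
  by (simp add: odd_ext_def)

text \<open>
  The factor \<open>2n + 1\<close> makes comparing keys on \<open>{-n..n}\<close> the lexicographic comparison of \<open>(F j, j)\<close>.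
\<close>

definition key :: "nat \<Rightarrow> (int \<Rightarrow> int) \<Rightarrow> int \<Rightarrow> int" where
  "key n f j = (2 * int n + 1) * odd_ext f j + j"

lemma key_minus [simp]: "key n f (- j) = - key n f j"
  by (simp add: key_def)

text \<open>Two letters differ by at most \<open>2n\<close>, so one unit of colour outweighs any
  difference of letters.\<close>

lemma key_less_iff:
  assumes "i \<in> {- int n..int n}" "j \<in> {- int n..int n}"
  shows "key n f i < key n f j \<longleftrightarrow>
    odd_ext f i < odd_ext f j \<or> odd_ext f i = odd_ext f j \<and> i < j"
proof -
  have *: "key n f i' < key n f j'"
    if "odd_ext f i' < odd_ext f j'" "i' \<in> {- int n..int n}" "j' \<in> {- int n..int n}" for i' j'
  proof -
    have "(2 * int n + 1) * (odd_ext f i' + 1) \<le> (2 * int n + 1) * odd_ext f j'"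
      using that(1) by (intro mult_left_mono) auto
    then show ?thesis using that by (simp add: key_def algebra_simps)
  qed
  consider "odd_ext f i < odd_ext f j" | "odd_ext f i = odd_ext f j" | "odd_ext f j < odd_ext f i"
    by linarith
  then show ?thesis
  proof cases
    case 1
    then show ?thesis using * assms by simp
  next
    case 2
    then show ?thesis by (simp add: key_def)
  next
    case 3
    then have "key n f j < key n f i" using * assms by simp
    then show ?thesis using 3 by simp
  qed
qed

lemma inj_on_key: "inj_on (key n f) {- int n..int n}"
proof (rule inj_onI)
  fix i j assume "i \<in> {- int n..int n}" "j \<in> {- int n..int n}" "key n f i = key n f j"
  then show "i = j" using key_less_iff[of i n j f] key_less_iff[of j n i f] by force
qed

definition standardization :: "nat \<Rightarrow> (int \<Rightarrow> int) \<Rightarrow> signed_perm" where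
  "standardization n f = (THE \<sigma>. sorts n (key n f) \<sigma>)"

lemma sorts_standardization: "sorts n (key n f) (standardization n f)"
  unfolding standardization_def
  by (rule theI') (metis key_minus inj_on_key sorts_exists sorts_unique)

lemma standardization_hyperoctahedral [simp]: "standardization n f \<in> hyperoctahedral n"
  using sorts_standardization by (simp add: sorts_def)

text \<open>Oddness mirrors each comparison at negative positions to one at nonnegative positions,
  so the adjacent pairs from \<open>0\<close> to \<open>n\<close> suffice.\<close>

lemma sorts_key_iff:
  assumes "\<sigma> \<in> hyperoctahedral n"
  shows "sorts n (key n f) \<sigma> \<longleftrightarrow> (\<forall>k\<in>{0..<int n}.
    odd_ext f (sapply \<sigma> k) < odd_ext f (sapply \<sigma> (k + 1)) \<or>
    odd_ext f (sapply \<sigma> k) = odd_ext f (sapply \<sigma> (k + 1)) \<and> sapply \<sigma> k < sapply \<sigma> (k + 1))"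
    (is "_ \<longleftrightarrow> ?R")
proof -
  let ?G = "\<lambda>k. key n f (sapply \<sigma> k)"
  have R: "?R \<longleftrightarrow> (\<forall>k\<in>{0..<int n}. ?G k < ?G (k + 1))"
  proof (rule ball_cong[OF refl])
    fix k assume "k \<in> {0..<int n}"
    then have "sapply \<sigma> k \<in> {- int n..int n}" "sapply \<sigma> (k + 1) \<in> {- int n..int n}"
      using sapply_range[OF assms, of k] sapply_range[OF assms, of "k + 1"] by simp_all
    then show "(odd_ext f (sapply \<sigma> k) < odd_ext f (sapply \<sigma> (k + 1)) \<or>
        odd_ext f (sapply \<sigma> k) = odd_ext f (sapply \<sigma> (k + 1)) \<and> sapply \<sigma> k < sapply \<sigma> (k + 1))
      \<longleftrightarrow> ?G k < ?G (k + 1)" using key_less_iff by simp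
  qed
  have "strict_mono_on {- int n..int n} ?G" if *: "\<forall>k\<in>{0..<int n}. ?G k < ?G (k + 1)"
  proof (rule strict_mono_on_int_intervalI)
    fix k assume k: "- int n \<le> k" "k < int n"
    show "?G k < ?G (k + 1)"
    proof (cases "0 \<le> k")
      case True
      then show ?thesis using * k by simp
    next
      case False
      then have "?G (- (k + 1)) < ?G (- (k + 1) + 1)" using * k by (intro bspec[OF *]) simp
      also have "- (k + 1) + 1 = - k" by simp
      finally show ?thesis unfolding sapply_minus key_minus by simp
    qed
  qed
  moreover have "?G k < ?G (k + 1)"
    if "strict_mono_on {- int n..int n} ?G" "k \<in> {0..<int n}" for k
    using that(2) by (intro strict_mono_onD[OF that(1)]) auto
  ultimately show ?thesis unfolding R sorts_def using assms by blast
qed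

lemma standardization_eq_iff:
  assumes "\<sigma> \<in> hyperoctahedral n"
  shows "standardization n f = \<sigma> \<longleftrightarrow> (\<forall>k\<in>{0..<int n}.
    odd_ext f (sapply \<sigma> k) < odd_ext f (sapply \<sigma> (k + 1)) \<or>
    odd_ext f (sapply \<sigma> k) = odd_ext f (sapply \<sigma> (k + 1)) \<and> sapply \<sigma> k < sapply \<sigma> (k + 1))"
  using sorts_key_iff[OF assms] sorts_standardization sorts_unique by metis

lemma standardization_less:
  assumes "k \<in> {- int n..int n}" "l \<in> {- int n..int n}" "k < l"
  shows "odd_ext f (sapply (standardization n f) k) < odd_ext f (sapply (standardization n f) l) \<or>
    odd_ext f (sapply (standardization n f) k) = odd_ext f (sapply (standardization n f) l) \<and>
    sapply (standardization n f) k < sapply (standardization n f) l"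
proof -
  let ?\<sigma> = "standardization n f"
  have "strict_mono_on {- int n..int n} (\<lambda>k. key n f (sapply ?\<sigma> k))"
    using sorts_standardization by (simp add: sorts_def)
  then have "key n f (sapply ?\<sigma> k) < key n f (sapply ?\<sigma> l)"
    using assms by (rule strict_mono_onD)
  moreover have "sapply ?\<sigma> k \<in> {- int n..int n}" "sapply ?\<sigma> l \<in> {- int n..int n}"
    using assms sapply_range[OF standardization_hyperoctahedral] by blast+
  ultimately show ?thesis using key_less_iff by blast
qed

text \<open>The parity \<open>p = 1\<close> belongs to \<open>\<phi>\<^sub>A\<close> and \<open>p = 0\<close> to \<open>\<psi>\<close>.\<close>

definition colours :: "int \<Rightarrow> int \<Rightarrow> int set" where
  "colours p a = {c. - 2 * a \<le> c \<and> c < 2 * a \<and> c mod 2 = p}"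

text \<open>The half-open range contains equally many integers of either parity, so the count of
  colourings is independent of \<open>p\<close>.\<close>

lemma colours_eq: "p \<in> {0, 1} \<Longrightarrow> colours p a = (\<lambda>i. 2 * i + p) ` {- a..<a}"
proof (intro equalityI subsetI)
  fix c assume "p \<in> {0, 1}" "c \<in> colours p a"
  then show "c \<in> (\<lambda>i. 2 * i + p) ` {- a..<a}"
    using mult_div_mod_eq[of 2 c] by (intro image_eqI[of _ _ "c div 2"]) (auto simp: colours_def)
qed (auto simp: colours_def)

lemma card_colours: "p \<in> {0, 1} \<Longrightarrow> card (colours p a) = nat (2 * a)"
  by (subst colours_eq) (auto simp: card_image inj_on_def)

lemma finite_colours: "p \<in> {0, 1} \<Longrightarrow> finite (colours p a)"
  by (simp add: colours_eq)

abbreviation colourings :: "nat \<Rightarrow> int \<Rightarrow> int \<Rightarrow> (int \<Rightarrow> int) set" where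
  "colourings n p a \<equiv> {1..int n} \<rightarrow>\<^sub>E colours p a"

lemma finite_colourings: "p \<in> {0, 1} \<Longrightarrow> finite (colourings n p a)"
  by (intro finite_PiE) (auto simp: finite_colours)

lemma card_colourings: "p \<in> {0, 1} \<Longrightarrow> card (colourings n p a) = nat (2 * a) ^ n"
  by (simp add: card_PiE card_colours)

text \<open>On positive letters the half-open range allows \<open>- 2 * a\<close> but not
  \<open>2 * a\<close>; negation reverses this on negative letters and preserves parity. These
  extreme cases decide the ties that occur under refinement.\<close>

lemma odd_ext_colouring:
  assumes f: "f \<in> colourings n p a" and j: "j \<in> {- int n..int n}" "j \<noteq> 0"
  shows "odd_ext f j \<ge> - 2 * a" "odd_ext f j \<le> 2 * a" "odd_ext f j mod 2 = p"
    "odd_ext f j = - 2 * a \<Longrightarrow> 0 < a \<Longrightarrow> 0 < j" "odd_ext f j = 2 * a \<Longrightarrow> 0 < a \<Longrightarrow> j < 0"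
proof -
  have c: "f \<bar>j\<bar> \<in> colours p a" using j by (intro PiE_mem[OF f]) auto
  consider "0 < j" | "j < 0" using j by linarith
  then have "odd_ext f j \<ge> - 2 * a \<and> odd_ext f j \<le> 2 * a \<and> odd_ext f j mod 2 = p \<and>
    (odd_ext f j = - 2 * a \<longrightarrow> 0 < a \<longrightarrow> 0 < j) \<and> (odd_ext f j = 2 * a \<longrightarrow> 0 < a \<longrightarrow> j < 0)"
  proof cases
    case 1
    then show ?thesis using c by (simp add: colours_def)
  next
    case 2
    have "(- f (- j)) mod 2 = f (- j) mod 2" by presburger
    then show ?thesis using c 2 by (simp add: colours_def odd_ext_neg)
  qed
  then show "odd_ext f j \<ge> - 2 * a" "odd_ext f j \<le> 2 * a" "odd_ext f j mod 2 = p"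
    "odd_ext f j = - 2 * a \<Longrightarrow> 0 < a \<Longrightarrow> 0 < j" "odd_ext f j = 2 * a \<Longrightarrow> 0 < a \<Longrightarrow> j < 0"
    by blast+
qed

text \<open>This is the comparison with position \<open>0\<close>, which holds the letter
  \<open>0\<close> of colour \<open>0\<close>.\<close>

lemma standardization_nonneg:
  assumes "i \<in> {1..int n}"
  shows "odd_ext f (sapply (standardization n f) i) \<ge> 0"
    "odd_ext f (sapply (standardization n f) i) = 0 \<Longrightarrow> sapply (standardization n f) i > 0"
  using standardization_less[of 0 n i f] assms by auto

section \<open>Refining one colouring by another\<close>

text \<open>A two-digit expansion: colours of \<open>g\<close> of equal parity are multiples of
  \<open>2\<close> apart, hence multiples of \<open>4 * a\<close> after scaling, and
  \<open>4 * a\<close> is the length of the colour range of \<open>f\<close>.\<close>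

definition refine :: "nat \<Rightarrow> int \<Rightarrow> (int \<Rightarrow> int) \<Rightarrow> (int \<Rightarrow> int) \<Rightarrow> int \<Rightarrow> int" where
  "refine n a f g = (\<lambda>j\<in>{1..int n}. 2 * a * odd_ext g (sapply (- standardization n f) j) + f j)"

lemma odd_ext_refine:
  assumes "j \<in> {- int n..int n}"
  shows "odd_ext (refine n a f g) j =
    2 * a * odd_ext g (sapply (- standardization n f) j) + odd_ext f j"
proof -
  consider "j = 0" | "0 < j" | "j < 0" by linarith
  then show ?thesis
  proof cases
    case 3
    then show ?thesis using assms by (simp add: refine_def odd_ext_neg)
  qed (use assms in \<open>simp_all add: refine_def\<close>)
qed

text \<open>Adding the bounds of the two summands gives too large a range. The standardization
  correlates them: letters at positive positions have nonnegative \<open>f\<close>-colour, and there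
  the colour of \<open>g\<close> stays below \<open>2 * b\<close>; negative positions are
  symmetric.\<close>

lemma refine_colourings:
  assumes a: "0 < a" and b: "0 < b" and f: "f \<in> colourings n p a" and g: "g \<in> colourings n q b"
  shows "refine n a f g \<in> colourings n p (2 * a * b)"
proof -
  let ?\<sigma> = "standardization n f"
  have "2 * a * odd_ext g (sapply (- ?\<sigma>) j) + f j \<in> colours p (2 * a * b)"
    if j: "j \<in> {1..int n}" for j
  proof -
    define i where "i = sapply (- ?\<sigma>) j"
    have ji: "j = sapply ?\<sigma> i" by (simp add: i_def)
    have i: "i \<in> {- int n..int n}" "i \<noteq> 0"
      using sapply_range[OF hyperoctahedral_uminus[OF standardization_hyperoctahedral], of n f j] j
      by (auto simp: i_def)
    have fj: "f j \<in> colours p a" using PiE_mem[OF f j] .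
    note gi = odd_ext_colouring[OF g i]
    have bounds: "- 4 * a * b \<le> 2 * a * odd_ext g i + f j \<and> 2 * a * odd_ext g i + f j < 4 * a * b"
    proof (cases "0 < i")
      case True
      then have "0 \<le> f j"
        using standardization_nonneg(1)[of i n f] i j by (simp flip: ji)
      moreover have "odd_ext g i \<le> 2 * b - 1" using gi(2,5) True b by linarith
      then have "2 * a * odd_ext g i \<le> 2 * a * (2 * b - 1)" using a by (intro mult_left_mono) auto
      then have "2 * a * odd_ext g i \<le> 4 * a * b - 2 * a" unfolding right_diff_distrib by linarith
      moreover have "2 * a * (- 2 * b) \<le> 2 * a * odd_ext g i"
        using gi(1) a by (intro mult_left_mono) auto
      then have "- 4 * a * b \<le> 2 * a * odd_ext g i" by simp
      moreover have "f j < 2 * a" using fj by (simp add: colours_def)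
      ultimately show ?thesis by linarith
    next
      case False
      \<comment> \<open>Colour \<open>0\<close> would force the letter \<open>- j\<close> at the
        positive position \<open>- i\<close> to be positive, contradicting
        \<open>j > 0\<close>.\<close>
      then have "f j \<le> 0" "f j \<noteq> 0"
        using standardization_nonneg[of "- i" n f] i j by (auto simp flip: ji)
      then have "f j < 0" by simp
      moreover have "2 * a * odd_ext g i \<le> 2 * a * (2 * b)"
        using gi(2) a by (intro mult_left_mono) auto
      then have "2 * a * odd_ext g i \<le> 4 * a * b" by linarith
      moreover have "1 - 2 * b \<le> odd_ext g i" using gi(1,4) False b by linarith
      then have "2 * a * (1 - 2 * b) \<le> 2 * a * odd_ext g i" using a by (intro mult_left_mono) auto
      then have "2 * a - 4 * a * b \<le> 2 * a * odd_ext g i" unfolding right_diff_distrib by linarith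
      moreover have "- 2 * a \<le> f j" using fj by (simp add: colours_def)
      ultimately show ?thesis by linarith
    qed
    have "(2 * a * odd_ext g i + f j) mod 2 = p"
      using fj by (simp add: colours_def mult.assoc)
    then show ?thesis using bounds by (simp add: colours_def i_def)
  qed
  then show ?thesis unfolding refine_def by (rule restrict_PiE_iff[THEN iffD2, OF ballI])
qed

text \<open>A strict increase of \<open>?G\<close> is at least \<open>2\<close>, so
  \<open>4 * a\<close> after scaling. The \<open>f\<close>-colours can only compensate this by
  falling from \<open>2 * a\<close> to \<open>- 2 * a\<close>, and then the first letter is negative
  and the second positive, so the tie is broken correctly.\<close>

lemma standardization_refine:
  assumes a: "0 < a" and b: "0 < b" and f: "f \<in> colourings n p a" and g: "g \<in> colourings n q b"
  shows "standardization n (refine n a f g) = standardization n f + standardization n g"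
proof (rule standardization_eq_iff[THEN iffD2], rule hyperoctahedral_plus, simp, simp, rule ballI)
  let ?\<sigma> = "standardization n f" and ?\<tau> = "standardization n g"
  let ?H = "odd_ext (refine n a f g)" and ?F = "odd_ext f" and ?G = "odd_ext g"
  fix k assume k: "k \<in> {0..<int n}"
  define i j where "i = sapply ?\<tau> k" and "j = sapply ?\<tau> (k + 1)"
  have ij: "i \<in> {- int n..int n}" "j \<in> {- int n..int n}"
    using k sapply_range[OF standardization_hyperoctahedral, of n g] by (auto simp: i_def j_def)
  have "j \<noteq> 0" using k by (simp add: j_def)
  have \<sigma>ij: "sapply ?\<sigma> i \<in> {- int n..int n}" "sapply ?\<sigma> j \<in> {- int n..int n}"
    using ij sapply_range[OF standardization_hyperoctahedral] by blast+
  have H: "?H (sapply ?\<sigma> i) = 2 * a * ?G i + ?F (sapply ?\<sigma> i)"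
      "?H (sapply ?\<sigma> j) = 2 * a * ?G j + ?F (sapply ?\<sigma> j)"
    using odd_ext_refine[OF \<sigma>ij(1)] odd_ext_refine[OF \<sigma>ij(2)] by simp_all
  have "sapply ?\<sigma> j \<noteq> 0" using \<open>j \<noteq> 0\<close> by simp
  note Fj = odd_ext_colouring[OF f \<sigma>ij(2) this]
  consider "?G i < ?G j" | "?G i = ?G j" "i < j"
    using standardization_less[of k n "k + 1" g] k by (auto simp: i_def j_def)
  then have "?H (sapply ?\<sigma> i) < ?H (sapply ?\<sigma> j) \<or>
    ?H (sapply ?\<sigma> i) = ?H (sapply ?\<sigma> j) \<and> sapply ?\<sigma> i < sapply ?\<sigma> j"
  proof cases
    case 1
    show ?thesis
    proof (cases "k = 0")
      \<comment> \<open>The letter \<open>0\<close> has colour \<open>0\<close> regardless of the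
        parity \<open>q\<close>, so only \<open>?G j \<ge> 1\<close> is available. This suffices
        because \<open>?H\<close> vanishes at \<open>0\<close>.\<close>
      case True
      then have "i = 0" by (simp add: i_def)
      then have "2 * a * 1 \<le> 2 * a * ?G j" using 1 a by (intro mult_left_mono) auto
      moreover have "?H (sapply ?\<sigma> i) = 0" "sapply ?\<sigma> i = 0" using \<open>i = 0\<close> by simp_all
      ultimately show ?thesis using Fj(1,4) a H(2) by linarith
    next
      case False
      then have "i \<noteq> 0" by (simp add: i_def)
      then have "sapply ?\<sigma> i \<noteq> 0" by simp
      note Fi = odd_ext_colouring[OF f \<sigma>ij(1) this]
      have "?G i mod 2 = ?G j mod 2"
        using odd_ext_colouring(3)[OF g ij(1)] odd_ext_colouring(3)[OF g ij(2)] \<open>i \<noteq> 0\<close> \<open>j \<noteq> 0\<close> by simp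
      then have "?G i + 2 \<le> ?G j" using 1 by presburger
      then have "2 * a * (?G i + 2) \<le> 2 * a * ?G j" using a by (intro mult_left_mono) auto
      then have "2 * a * ?G i + 4 * a \<le> 2 * a * ?G j" by (simp add: algebra_simps)
      then show ?thesis using Fi(2,5) Fj(1,4) a H by linarith
    qed
  next
    case 2
    \<comment> \<open>The scaled \<open>g\<close>-colours cancel, and \<open>i < j\<close> leaves
      the comparison made by the standardization of \<open>f\<close>.\<close>
    then show ?thesis using standardization_less[of i n j f] ij H by simp
  qed
  then show "?H (sapply (?\<sigma> + ?\<tau>) k) < ?H (sapply (?\<sigma> + ?\<tau>) (k + 1)) \<or>
    ?H (sapply (?\<sigma> + ?\<tau>) k) = ?H (sapply (?\<sigma> + ?\<tau>) (k + 1)) \<and>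
    sapply (?\<sigma> + ?\<tau>) k < sapply (?\<sigma> + ?\<tau>) (k + 1)"
    by (simp add: i_def j_def)
qed

text \<open>Before \<open>f = f'\<close> is known, the two standardizations may differ, so only the
  common parity of the \<open>g\<close>-colours is used: \<open>f' j - f j\<close> is a multiple of
  \<open>4 * a\<close> of smaller absolute value. Once \<open>f\<close> is recovered, so is its
  standardization, and then \<open>g\<close>.\<close>

lemma inj_on_refine:
  assumes a: "0 < a"
  shows "inj_on (\<lambda>(f, g). refine n a f g) (colourings n p a \<times> colourings n q b)"
proof (rule inj_onI, clarify)
  fix f g f' g'
  assume f: "f \<in> colourings n p a" and g: "g \<in> colourings n q b"
    and f': "f' \<in> colourings n p a" and g': "g' \<in> colourings n q b"
    and eq: "refine n a f g = refine n a f' g'"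
  have "f j = f' j" if j: "j \<in> {1..int n}" for j
  proof -
    let ?i = "sapply (- standardization n f) j" and ?i' = "sapply (- standardization n f') j"
    have i: "?i \<in> {- int n..int n}" "?i' \<in> {- int n..int n}" "?i \<noteq> 0" "?i' \<noteq> 0"
      using sapply_range[OF hyperoctahedral_uminus[OF standardization_hyperoctahedral], of n _ j] j
      by auto
    have "odd_ext g ?i mod 2 = odd_ext g' ?i' mod 2"
      using odd_ext_colouring(3)[OF g i(1,3)] odd_ext_colouring(3)[OF g' i(2,4)] by simp
    then obtain m where m: "odd_ext g ?i = odd_ext g' ?i' + 2 * m"
      by (metis add.commute diff_add_cancel dvdE mod_eq_dvd_iff)
    have "refine n a f g j = refine n a f' g' j" using eq by simp
    then have "4 * a * m = f' j - f j" using j m by (simp add: refine_def algebra_simps)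
    moreover have "- 4 * a < f' j - f j" "f' j - f j < 4 * a"
      using PiE_mem[OF f j] PiE_mem[OF f' j] by (auto simp: colours_def)
    ultimately have "4 * a * (- 1) < 4 * a * m" "4 * a * m < 4 * a * 1" by auto
    then have "- 1 < m" "m < 1" using a by (simp_all only: mult_less_cancel_left_pos)
    then have "m = 0" by simp
    with \<open>4 * a * m = f' j - f j\<close> show ?thesis by simp
  qed
  then have ff': "f = f'" by (rule PiE_ext[OF f f'])
  have "g k = g' k" if k: "k \<in> {1..int n}" for k
  proof -
    have "sapply (standardization n f) k \<in> {- int n..int n}"
      using k by (subst sapply_range) auto
    from odd_ext_refine[OF this, of a f g] odd_ext_refine[OF this, of a f g']
    have "2 * a * odd_ext g k = 2 * a * odd_ext g' k" unfolding eq[folded ff'] sapply_uminus_cancel by linarith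
    then have "odd_ext g k = odd_ext g' k" using a by simp
    then show ?thesis using k by simp
  qed
  then have "g = g'" by (rule PiE_ext[OF g g'])
  with ff' show "f = f' \<and> g = g'" by simp
qed

lemma bij_betw_refine:
  assumes a: "0 < a" and b: "0 < b" and p: "p \<in> {0, 1}" and q: "q \<in> {0, 1}"
  shows "bij_betw (\<lambda>(f, g). refine n a f g) (colourings n p a \<times> colourings n q b)
    (colourings n p (2 * a * b))"
proof -
  let ?r = "\<lambda>(f, g). refine n a f g" and ?D = "colourings n p a \<times> colourings n q b"
  have "card (?r ` ?D) = card ?D" by (rule card_image[OF inj_on_refine[OF a]])
  also have "\<dots> = (nat (2 * a) * nat (2 * b)) ^ n"
    by (simp add: card_cartesian_product card_colourings[OF p] card_colourings[OF q] power_mult_distrib)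
  also have "nat (2 * a) * nat (2 * b) = nat (2 * (2 * a * b))"
    using a b by (simp flip: nat_mult_distrib add: algebra_simps)
  also have "\<dots> ^ n = card (colourings n p (2 * a * b))" by (rule card_colourings[OF p, symmetric])
  finally have card: "card (?r ` ?D) = card (colourings n p (2 * a * b))" .
  have "?r ` ?D \<subseteq> colourings n p (2 * a * b)"
  proof (rule image_subsetI)
    fix x assume "x \<in> ?D"
    then obtain f g where x: "x = (f, g)" and f: "f \<in> colourings n p a" and g: "g \<in> colourings n q b"
      by (rule SigmaE)
    show "?r x \<in> colourings n p (2 * a * b)"
      unfolding x prod.case by (rule refine_colourings[OF a b f g])
  qed
  then have "?r ` ?D = colourings n p (2 * a * b)"
    by (rule card_subset_eq[OF finite_colourings[OF p] _ card])
  then show ?thesis using inj_on_refine[OF a] by (simp add: bij_betw_def)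
qed

section \<open>Fibres of the standardization\<close>

definition descents :: "nat \<Rightarrow> int \<Rightarrow> signed_perm \<Rightarrow> nat" where
  "descents n p \<pi> = (if p = 1 then des_A n \<pi> else ades n \<pi>)"

text \<open>The value \<open>1\<close> marks the places where equal neighbouring colours are
  forbidden. For \<open>p = 1\<close> there are none at the two ends, since an odd colour equals
  neither \<open>0\<close> nor \<open>2 * a\<close>.\<close>

definition gap :: "nat \<Rightarrow> int \<Rightarrow> signed_perm \<Rightarrow> int \<Rightarrow> int" where
  "gap n p \<pi> k = (if p = 1 \<and> (k = 0 \<or> k = int n) then 0
     else if sapply \<pi> k > (if k = int n then 0 else sapply \<pi> (k + 1)) then 1 else 0)"

lemma sum_gap:
  assumes "p \<in> {0, 1}"
  shows "(\<Sum>k\<in>{0..int n}. gap n p \<pi> k) = int (descents n p \<pi>)"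
proof (cases "p = 1")
  case True
  have "(\<Sum>k\<in>{0..int n}. gap n p \<pi> k) =
    (\<Sum>k\<in>{1..int n - 1}. if sapply \<pi> k > sapply \<pi> (k + 1) then 1 else 0)"
    by (rule sum.mono_neutral_cong_right) (auto simp: gap_def True)
  also have "\<dots> = int (des_A n \<pi>)" by (simp add: des_A_def sum.If_cases Int_def conj_commute)
  finally show ?thesis using True by (simp add: descents_def)
next
  case False
  have "(\<Sum>k\<in>{0..int n}. gap n p \<pi> k) =
    (\<Sum>k\<in>{0..int n}. if sapply \<pi> k > (if k = int n then 0 else sapply \<pi> (k + 1)) then 1 else 0)"
    using False by (intro sum.cong) (auto simp: gap_def)
  also have "\<dots> = int (ades n \<pi>)"
    unfolding ades_def by (subst sum.If_cases) (simp_all only: finite_atLeastAtMost_int Int_def mem_Collect_eq, simp)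
  finally show ?thesis using False by (simp add: descents_def)
qed

text \<open>For \<open>a > 0\<close> this makes \<open>a - p + n - descents\<close> nonnegative, so
  that conversion to a natural number loses nothing.\<close>

lemma descents_le:
  assumes "1 \<le> n" "p \<in> {0, 1}"
  shows "int (descents n p \<pi>) \<le> int n + 1 - 2 * p"
proof -
  have "des_A n \<pi> \<le> card {1..int n - 1}" unfolding des_A_def by (rule card_mono) auto
  moreover have "ades n \<pi> \<le> card {0..int n}" unfolding ades_def by (rule card_mono) auto
  ultimately show ?thesis using assms by (auto simp: descents_def)
qed

text \<open>
  With \<open>F (\<pi> k) = 2 t k + p\<close>, the colourings with standardization \<open>\<pi>\<close> become the sequences
  \<open>0 \<le> t 1 \<le> \<dots> \<le> t n \<le> a - p\<close> that are strict wherever \<open>gap\<close> is \<open>1\<close>.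
\<close>

lemma card_standardization_fibre:
  assumes n: "1 \<le> n" and p: "p \<in> {0, 1}" and a: "0 < a" and \<pi>: "\<pi> \<in> hyperoctahedral n"
  shows "card {f \<in> colourings n p a. standardization n f = \<pi>} =
    nat (a - p + int n - int (descents n p \<pi>)) choose n"
proof -
  let ?I = "{1..int n}"
  let ?T = "{t \<in> ?I \<rightarrow>\<^sub>E UNIV. gap n p \<pi> 0 \<le> t 1 \<and>
    (\<forall>k\<in>{1..<int n}. t k + gap n p \<pi> k \<le> t (k + 1)) \<and> t (int n) + gap n p \<pi> (int n) \<le> a - p}"
  let ?C = "{f \<in> colourings n p a. standardization n f = \<pi>}"
  \<comment> \<open>\<open>s t\<close> is the colouring read along positions; \<open>\<Phi>\<close>
    transports it to letters and \<open>\<Psi>\<close> goes back.\<close>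
  define s :: "(int \<Rightarrow> int) \<Rightarrow> int \<Rightarrow> int" where "s t k = 2 * t k + p" for t k
  define \<Phi> where "\<Phi> t = (\<lambda>j\<in>?I. odd_ext (s t) (sapply (- \<pi>) j))" for t
  define \<Psi> where "\<Psi> f = (\<lambda>k\<in>?I. (odd_ext f (sapply \<pi> k) - p) div 2)" for f
  have \<Phi>: "odd_ext (\<Phi> t) (sapply \<pi> k) = odd_ext (s t) k" if "k \<in> {- int n..int n}" for t k
  proof -
    have r: "sapply \<pi> k \<in> {- int n..int n}" using that sapply_range[OF \<pi>] by blast
    consider "sapply \<pi> k = 0" | "0 < sapply \<pi> k" | "sapply \<pi> k < 0" by linarith
    then show ?thesis
    proof cases
      case 3
      then show ?thesis using r by (simp add: \<Phi>_def odd_ext_neg)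
    qed (use r in \<open>simp_all add: \<Phi>_def\<close>)
  qed
  have ends: "sapply \<pi> 1 \<noteq> 0" "sapply \<pi> (int n) \<noteq> 0" using n by simp_all
  then have signs: "sapply \<pi> 1 < 0 \<or> 0 < sapply \<pi> 1"
    "sapply \<pi> (int n) < 0 \<or> 0 < sapply \<pi> (int n)" by linarith+
  have std: "standardization n (\<Phi> t) = \<pi>" if t: "t \<in> ?T" for t
  proof (rule standardization_eq_iff[OF \<pi>, THEN iffD2], rule ballI)
    fix k assume k: "k \<in> {0..<int n}"
    have eq: "odd_ext (\<Phi> t) (sapply \<pi> k) = odd_ext (s t) k"
      "odd_ext (\<Phi> t) (sapply \<pi> (k + 1)) = s t (k + 1)"
      using k \<Phi>[of k t] \<Phi>[of "k + 1" t] by simp_all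
    show "odd_ext (\<Phi> t) (sapply \<pi> k) < odd_ext (\<Phi> t) (sapply \<pi> (k + 1)) \<or>
      odd_ext (\<Phi> t) (sapply \<pi> k) = odd_ext (\<Phi> t) (sapply \<pi> (k + 1)) \<and>
      sapply \<pi> k < sapply \<pi> (k + 1)"
    proof (cases "k = 0")
      case True
      have "gap n p \<pi> 0 \<le> t 1" using t by blast
      then show ?thesis
        using True p signs(1) n unfolding eq by (auto simp: s_def gap_def split: if_splits)
    next
      case False
      then have "t k + gap n p \<pi> k \<le> t (k + 1)" using t k by auto
      moreover have "sapply \<pi> k \<noteq> sapply \<pi> (k + 1)" by simp
      then have "sapply \<pi> k < sapply \<pi> (k + 1) \<or> sapply \<pi> k > sapply \<pi> (k + 1)" by linarith
      ultimately show ?thesis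
        using False k unfolding eq by (auto simp: s_def gap_def split: if_splits)
    qed
  qed
  have col: "\<Phi> t \<in> colourings n p a" if t: "t \<in> ?T" for t
  proof -
    have bounds: "0 \<le> s t k \<and> s t k \<le> 2 * a \<and> (s t k = 2 * a \<longrightarrow> sapply \<pi> k < 0)"
      if k: "k \<in> ?I" for k
    proof -
      have top: "t (int n) + gap n p \<pi> (int n) \<le> a - p" using t by blast
      \<comment> \<open>Colour \<open>2 * a\<close> is admissible only on a negative letter; on a
        positive one the last gap, or the parity for \<open>p = 1\<close>, excludes it.\<close>
      have 1: "s t (int n) \<le> 2 * a \<and> (s t (int n) = 2 * a \<longrightarrow> sapply \<pi> (int n) < 0)"
        using top p signs(2) by (auto simp: s_def gap_def split: if_splits)
      have 2: "0 \<le> s t k"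
        using standardization_nonneg(1)[OF k, of "\<Phi> t"] \<Phi>[of k t] k unfolding std[OF t] by simp
      show ?thesis
      proof (cases "k = int n")
        case True
        then show ?thesis using 1 2 by simp
      next
        case False
        \<comment> \<open>The bound propagates down from position \<open>n\<close>: a colour
          \<open>2 * a\<close> at \<open>k\<close> ties with the last one, so its letter is smaller
          still and hence negative.\<close>
        then have "s t k < s t (int n) \<or> s t k = s t (int n) \<and> sapply \<pi> k < sapply \<pi> (int n)"
          using standardization_less[of k n "int n" "\<Phi> t"] \<Phi>[of k t] \<Phi>[of "int n" t] k
          unfolding std[OF t] by simp
        then show ?thesis using 1 2 by linarith
      qed
    qed
    have "odd_ext (s t) (sapply (- \<pi>) j) \<in> colours p a" if j: "j \<in> ?I" for j
    proof -
      define k where "k = sapply (- \<pi>) j"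
      have jk: "j = sapply \<pi> k" by (simp add: k_def)
      have k: "k \<in> {- int n..int n}" "k \<noteq> 0"
        using sapply_range[OF hyperoctahedral_uminus[OF \<pi>], of j] j by (auto simp: k_def)
      have par: "s t i mod 2 = p \<and> (- s t i) mod 2 = p" for i
      proof -
        have "p = 0 \<or> p = 1" using p by simp
        then show ?thesis unfolding s_def by presburger
      qed
      show ?thesis
      proof (cases "0 < k")
        case True
        then show ?thesis
          using bounds[of k] par[of k] k j a unfolding k_def[symmetric] by (auto simp: colours_def jk)
      next
        case False
        then have "- k \<in> ?I" using k by auto
        then show ?thesis
          using bounds[of "- k"] par[of "- k"] False k j a unfolding k_def[symmetric]
          by (auto simp: colours_def jk odd_ext_neg)
      qed
    qed
    then show ?thesis unfolding \<Phi>_def by (rule restrict_PiE_iff[THEN iffD2, OF ballI])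
  qed
  have \<Psi>: "odd_ext f (sapply \<pi> k) = 2 * \<Psi> f k + p" if f: "f \<in> ?C" and k: "k \<in> ?I" for f k
  proof -
    have "sapply \<pi> k \<in> {- int n..int n}" using k by (subst sapply_range[OF \<pi>]) auto
    then have "odd_ext f (sapply \<pi> k) mod 2 = p"
      using f k odd_ext_colouring(3)[of f n p a "sapply \<pi> k"] by simp
    then have "odd_ext f (sapply \<pi> k) = 2 * ((odd_ext f (sapply \<pi> k) - p) div 2) + p" by presburger
    then show ?thesis using k by (simp add: \<Psi>_def)
  qed
  have "bij_betw \<Phi> ?T ?C"
  proof (rule bij_betw_byWitness[where f' = \<Psi>])
    show "\<forall>t\<in>?T. \<Psi> (\<Phi> t) = t"
    proof
      fix t assume t: "t \<in> ?T"
      have "\<Psi> (\<Phi> t) k = t k" if "k \<in> ?I" for k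
        using that \<Phi>[of k t] by (simp add: \<Psi>_def s_def)
      moreover have "\<Psi> (\<Phi> t) \<in> ?I \<rightarrow>\<^sub>E UNIV" "t \<in> ?I \<rightarrow>\<^sub>E UNIV" using t by (auto simp: \<Psi>_def)
      ultimately show "\<Psi> (\<Phi> t) = t" by (intro PiE_ext)
    qed
    show "\<forall>f\<in>?C. \<Phi> (\<Psi> f) = f"
    proof
      fix f assume f: "f \<in> ?C"
      have pos: "odd_ext (s (\<Psi> f)) k = odd_ext f (sapply \<pi> k)" if "k \<in> ?I" for k
        using that \<Psi>[OF f that] by (simp add: s_def)
      have all: "odd_ext (s (\<Psi> f)) k = odd_ext f (sapply \<pi> k)" if "k \<in> {- int n..int n}" for k
      proof -
        have "k = 0 \<or> k \<in> ?I \<or> - k \<in> ?I" using that by auto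
        then consider "k = 0" | "k \<in> ?I" | "- k \<in> ?I" by blast
        then show ?thesis using pos[of k] pos[of "- k"] by cases simp_all
      qed
      have "\<Phi> (\<Psi> f) j = f j" if j: "j \<in> ?I" for j
      proof -
        have "sapply (- \<pi>) j \<in> {- int n..int n}"
          using j by (subst sapply_range[OF hyperoctahedral_uminus[OF \<pi>]]) auto
        then show ?thesis using j by (simp add: \<Phi>_def all)
      qed
      moreover have "\<Phi> (\<Psi> f) \<in> ?I \<rightarrow>\<^sub>E UNIV" "f \<in> ?I \<rightarrow>\<^sub>E UNIV" using f by (auto simp: \<Phi>_def)
      ultimately show "\<Phi> (\<Psi> f) = f" by (intro PiE_ext)
    qed
    show "\<Phi> ` ?T \<subseteq> ?C" using std col by blast
    show "\<Psi> ` ?C \<subseteq> ?T"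
    proof (rule image_subsetI)
      fix f assume f: "f \<in> ?C"
      then have fc: "f \<in> colourings n p a" and fs: "standardization n f = \<pi>" by auto
      have one: "1 \<in> ?I" and top: "int n \<in> ?I" using n by auto
      have "gap n p \<pi> 0 \<le> \<Psi> f 1"
        using standardization_less[of 0 n 1 f] \<Psi>[OF f one] p n unfolding fs
        by (auto simp: gap_def)
      moreover have "\<Psi> f k + gap n p \<pi> k \<le> \<Psi> f (k + 1)" if k: "k \<in> {1..<int n}" for k
        using standardization_less[of k n "k + 1" f] \<Psi>[OF f, of k] \<Psi>[OF f, of "k + 1"] k
        unfolding fs by (auto simp: gap_def)
      moreover have "\<Psi> f (int n) + gap n p \<pi> (int n) \<le> a - p"
      proof -
        have "sapply \<pi> (int n) \<in> {- int n..int n}" using n by (subst sapply_range[OF \<pi>]) auto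
        from odd_ext_colouring(2,5)[OF fc this ends(2)]
        have "odd_ext f (sapply \<pi> (int n)) < 2 * a \<or>
            odd_ext f (sapply \<pi> (int n)) = 2 * a \<and> sapply \<pi> (int n) < 0"
          using a by linarith
        then show ?thesis using \<Psi>[OF f top] p n by (auto simp: gap_def)
      qed
      ultimately show "\<Psi> f \<in> ?T" by (auto simp: \<Psi>_def)
    qed
  qed
  then have "card ?C = card ?T" by (simp add: bij_betw_same_card)
  also have "\<dots> = nat (a - p + int n - (\<Sum>i\<in>{0..int n}. gap n p \<pi> i)) choose n"
    using p a descents_le[OF n p, of \<pi>]
    by (intro card_gap_sequences n) (auto simp: sum_gap)
  finally show ?thesis using p by (simp add: sum_gap)
qed

section \<open>The product formula\<close>

definition fibre_card :: "nat \<Rightarrow> int \<Rightarrow> int \<Rightarrow> signed_perm \<Rightarrow> nat" where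
  "fibre_card n p a \<sigma> = card {f \<in> colourings n p a. standardization n f = \<sigma>}"

lemma sum_standardization:
  fixes w :: "signed_perm \<Rightarrow> nat"
  assumes "p \<in> {0, 1}"
  shows "(\<Sum>f\<in>colourings n p a. w (standardization n f)) =
    (\<Sum>\<sigma>\<in>hyperoctahedral n. fibre_card n p a \<sigma> * w \<sigma>)"
proof -
  have "(\<Sum>f\<in>colourings n p a. w (standardization n f)) =
      (\<Sum>\<sigma>\<in>hyperoctahedral n. \<Sum>f | f \<in> colourings n p a \<and> standardization n f = \<sigma>.
        w (standardization n f))"
    by (rule sum.group[OF finite_colourings[OF assms] finite_hyperoctahedral, symmetric]) auto
  also have "\<dots> = (\<Sum>\<sigma>\<in>hyperoctahedral n. fibre_card n p a \<sigma> * w \<sigma>)"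
    by (rule sum.cong[OF refl]) (simp add: fibre_card_def)
  finally show ?thesis .
qed

text \<open>The left side counts the pairs \<open>(f, g)\<close> whose standardizations compose to
  \<open>\<pi>\<close>; refinement maps these bijectively to the colourings with standardization
  \<open>\<pi>\<close>.\<close>

lemma sum_fibre_card_mult:
  assumes a: "0 < a" and b: "0 < b" and p: "p \<in> {0, 1}" and q: "q \<in> {0, 1}"
    and \<pi>: "\<pi> \<in> hyperoctahedral n"
  shows "(\<Sum>\<sigma>\<in>hyperoctahedral n. \<Sum>\<tau>\<in>hyperoctahedral n.
      if \<sigma> + \<tau> = \<pi> then fibre_card n p a \<sigma> * fibre_card n q b \<tau> else 0) =
    fibre_card n p (2 * a * b) \<pi>"
proof -
  let ?w = "\<lambda>\<sigma>. of_bool (\<sigma> = \<pi>) :: nat"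
  have "fibre_card n p (2 * a * b) \<pi> =
      (\<Sum>\<sigma>\<in>hyperoctahedral n. fibre_card n p (2 * a * b) \<sigma> * ?w \<sigma>)"
    using \<pi> by (simp add: of_bool_def if_distrib[of "(*) _"] finite_hyperoctahedral cong: if_cong)
  also have "\<dots> = (\<Sum>h\<in>colourings n p (2 * a * b). ?w (standardization n h))"
    by (rule sum_standardization[OF p, symmetric])
  also have "\<dots> = (\<Sum>(f, g)\<in>colourings n p a \<times> colourings n q b. ?w (standardization n (refine n a f g)))"
    using sum.reindex_bij_betw[OF bij_betw_refine[OF a b p q], of "\<lambda>h. ?w (standardization n h)" n]
    by (simp add: case_prod_unfold)
  also have "\<dots> = (\<Sum>(f, g)\<in>colourings n p a \<times> colourings n q b.
      ?w (standardization n f + standardization n g))"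
    by (rule sum.cong[OF refl]) (clarify, subst standardization_refine[OF a b], assumption+, simp)
  also have "\<dots> = (\<Sum>f\<in>colourings n p a. \<Sum>g\<in>colourings n q b.
      ?w (standardization n f + standardization n g))"
    by (rule sum.cartesian_product[symmetric])
  also have "\<dots> = (\<Sum>f\<in>colourings n p a. \<Sum>\<tau>\<in>hyperoctahedral n.
      fibre_card n q b \<tau> * ?w (standardization n f + \<tau>))"
    by (rule sum.cong[OF refl], rule sum_standardization[OF q])
  also have "\<dots> = (\<Sum>\<sigma>\<in>hyperoctahedral n. fibre_card n p a \<sigma> *
      (\<Sum>\<tau>\<in>hyperoctahedral n. fibre_card n q b \<tau> * ?w (\<sigma> + \<tau>)))"
    by (rule sum_standardization[OF p])
  also have "\<dots> = (\<Sum>\<sigma>\<in>hyperoctahedral n. \<Sum>\<tau>\<in>hyperoctahedral n.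
      if \<sigma> + \<tau> = \<pi> then fibre_card n p a \<sigma> * fibre_card n q b \<tau> else 0)"
    by (auto simp: sum_distrib_left intro!: sum.cong)
  finally show ?thesis by simp
qed

section \<open>From positive even integer arguments to polynomial identities\<close>

definition eval_xy :: "rat \<Rightarrow> rat \<Rightarrow> rat poly poly \<Rightarrow> rat" where
  "eval_xy x y P = poly (poly P [:y:]) x"

lemma eval_xy_simps [simp]:
  "eval_xy x y (P + Q) = eval_xy x y P + eval_xy x y Q"
  "eval_xy x y (P - Q) = eval_xy x y P - eval_xy x y Q"
  "eval_xy x y (P * Q) = eval_xy x y P * eval_xy x y Q"
  "eval_xy x y (sum F A) = (\<Sum>i\<in>A. eval_xy x y (F i))"
  "eval_xy x y (of_nat k) = of_nat k"
  "eval_xy x y 0 = 0"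
  "eval_xy x y var_x = x"
  "eval_xy x y var_y = y"
  "eval_xy x y half = 1 / 2"
  by (simp_all add: eval_xy_def poly_sum var_x_def var_y_def half_def)

lemma eval_xy_of_int [simp]: "eval_xy x y (of_int k) = of_int k"
  by (cases k rule: int_cases2) (simp_all add: eval_xy_def)

lemma eval_xy_binom_poly: "eval_xy x y (binom_poly z k) = eval_xy x y z gchoose k"
  by (simp add: eval_xy_def binom_poly_def gbinomial_prod_rev poly_prod atLeast0LessThan)

text \<open>For each fixed \<open>y = 2 * b\<close> the difference is a polynomial in
  \<open>x\<close> with infinitely many roots, hence zero. As a polynomial in \<open>y\<close> over
  the domain \<open>rat poly\<close>, the difference then has infinitely many constant
  roots.\<close>

lemma eval_xy_eqI:
  assumes "\<And>a b :: int. 0 < a \<Longrightarrow> 0 < b \<Longrightarrow>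
    eval_xy (2 * of_int a) (2 * of_int b) P = eval_xy (2 * of_int a) (2 * of_int b) Q"
  shows "P = Q"
proof -
  have inf: "infinite {0::int<..}" by (rule infinite_Ioi)
  have row: "poly (P - Q) [:2 * of_int b:] = 0" if b: "0 < b" for b :: int
  proof (rule ccontr)
    assume "poly (P - Q) [:2 * of_int b:] \<noteq> 0"
    then have "finite {x. poly (poly (P - Q) [:2 * of_int b:]) x = 0}" by (rule poly_roots_finite)
    moreover have "(\<lambda>a. 2 * of_int a) ` {0::int<..} \<subseteq> {x. poly (poly (P - Q) [:2 * of_int b:]) x = 0}"
      using assms[OF _ b] by (auto simp: eval_xy_def)
    ultimately have "finite ((\<lambda>a. 2 * of_int a :: rat) ` {0::int<..})" by (rule finite_subset[rotated])
    then show False using inf by (auto dest!: finite_imageD simp: inj_on_def)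
  qed
  have "P - Q = 0"
  proof (rule ccontr)
    assume "P - Q \<noteq> 0"
    then have "finite {z. poly (P - Q) z = 0}" by (rule poly_roots_finite)
    moreover have "(\<lambda>b. [:2 * of_int b:]) ` {0::int<..} \<subseteq> {z. poly (P - Q) z = 0}"
      using row by auto
    ultimately have "finite ((\<lambda>b. [:2 * of_int b :: rat:]) ` {0::int<..})" by (rule finite_subset[rotated])
    then show False using inf by (auto dest!: finite_imageD simp: inj_on_def)
  qed
  then show ?thesis by simp
qed

definition coefficient :: "nat \<Rightarrow> int \<Rightarrow> rat poly poly \<Rightarrow> signed_perm \<Rightarrow> rat poly poly" where
  "coefficient n p z \<pi> = binom_poly (z + of_nat n - of_int p - of_nat (descents n p \<pi>)) n"

text \<open>By \<open>descents_le\<close> the upper index evaluates to a natural number, so the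
  generalised binomial coefficient is the ordinary one counting the fibre.\<close>

lemma eval_xy_coefficient:
  assumes n: "1 \<le> n" and p: "p \<in> {0, 1}" and a: "0 < a" and \<pi>: "\<pi> \<in> hyperoctahedral n"
    and z: "eval_xy x y z = of_int a"
  shows "eval_xy x y (coefficient n p z \<pi>) = of_nat (fibre_card n p a \<pi>)"
proof -
  define m where "m = nat (a - p + int n - int (descents n p \<pi>))"
  have "int m = a - p + int n - int (descents n p \<pi>)"
    using p a descents_le[OF n p, of \<pi>] by (auto simp: m_def)
  then have "rat_of_int (int m) = of_int (a - p + int n - int (descents n p \<pi>))" by (rule arg_cong)
  then have "of_int a + of_nat n - of_int p - of_nat (descents n p \<pi>) = rat_of_nat m" by simp
  then have "eval_xy x y (coefficient n p z \<pi>) = of_nat m gchoose n"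
    by (simp add: coefficient_def eval_xy_binom_poly z)
  then show ?thesis
    using card_standardization_fibre[OF n p a \<pi>]
    by (simp add: fibre_card_def m_def binomial_gbinomial)
qed

lemma lookup_mult_sum_single:
  fixes c d :: "'b::monoid_add \<Rightarrow> 'a::semiring_0"
  shows "Poly_Mapping.lookup ((\<Sum>\<sigma>\<in>A. Poly_Mapping.single \<sigma> (c \<sigma>)) * (\<Sum>\<tau>\<in>B. Poly_Mapping.single \<tau> (d \<tau>))) \<pi> =
    (\<Sum>\<sigma>\<in>A. \<Sum>\<tau>\<in>B. if \<sigma> + \<tau> = \<pi> then c \<sigma> * d \<tau> else 0)"
  by (simp add: sum_product mult_single lookup_sum lookup_single when_def)

text \<open>Covers both product formulas: \<open>p = 1\<close>, \<open>q = 0\<close> gives the first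
  and \<open>p = 0\<close>, \<open>q = 1\<close> the second. The parity of the left factor
  survives.\<close>

lemma sum_coefficient_mult:
  assumes n: "1 \<le> n" and p: "p \<in> {0, 1}" and q: "q \<in> {0, 1}"
  shows "(\<Sum>\<sigma>\<in>hyperoctahedral n. Poly_Mapping.single \<sigma> (coefficient n p (half * var_x) \<sigma>)) *
      (\<Sum>\<tau>\<in>hyperoctahedral n. Poly_Mapping.single \<tau> (coefficient n q (half * var_y) \<tau>)) =
    (\<Sum>\<pi>\<in>hyperoctahedral n. Poly_Mapping.single \<pi> (coefficient n p (half * (var_x * var_y)) \<pi>))"
    (is "?L = ?R")
proof (rule poly_mapping_eqI)
  fix \<pi>
  let ?B = "hyperoctahedral n"
  have R: "Poly_Mapping.lookup ?R \<pi> = (if \<pi> \<in> ?B then coefficient n p (half * (var_x * var_y)) \<pi> else 0)"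
    by (simp add: lookup_sum lookup_single when_def finite_hyperoctahedral)
  show "Poly_Mapping.lookup ?L \<pi> = Poly_Mapping.lookup ?R \<pi>"
  proof (cases "\<pi> \<in> ?B")
    case False
    \<comment> \<open>Outside the group both coefficients vanish, since the group is closed under
      composition.\<close>
    then have "\<sigma> + \<tau> \<noteq> \<pi>" if "\<sigma> \<in> ?B" "\<tau> \<in> ?B" for \<sigma> \<tau>
      using hyperoctahedral_plus[OF that] by blast
    then show ?thesis using False unfolding R lookup_mult_sum_single by simp
  next
    case \<pi>: True
    have "Poly_Mapping.lookup ?L \<pi> = coefficient n p (half * (var_x * var_y)) \<pi>"
    proof (rule eval_xy_eqI)
      fix a b :: int assume a: "0 < a" and b: "0 < b"
      let ?e = "eval_xy (2 * of_int a) (2 * of_int b)"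
      have x: "?e (coefficient n p (half * var_x) \<sigma>) = of_nat (fibre_card n p a \<sigma>)"
        if "\<sigma> \<in> ?B" for \<sigma> by (rule eval_xy_coefficient[OF n p a that]) simp
      have y: "?e (coefficient n q (half * var_y) \<tau>) = of_nat (fibre_card n q b \<tau>)"
        if "\<tau> \<in> ?B" for \<tau> by (rule eval_xy_coefficient[OF n q b that]) simp
      have xy: "?e (coefficient n p (half * (var_x * var_y)) \<pi>) =
          of_nat (fibre_card n p (2 * a * b) \<pi>)"
        \<comment> \<open>At \<open>x = 2 * a\<close> and \<open>y = 2 * b\<close>, half the product
          is \<open>2 * a * b\<close>, the colour bound of refinements.\<close>
        by (rule eval_xy_coefficient[OF n p _ \<pi>]) (use a b in simp_all)
      have "?e (Poly_Mapping.lookup ?L \<pi>) = of_nat (\<Sum>\<sigma>\<in>?B. \<Sum>\<tau>\<in>?B.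
          if \<sigma> + \<tau> = \<pi> then fibre_card n p a \<sigma> * fibre_card n q b \<tau> else 0)"
        unfolding lookup_mult_sum_single
        by (auto simp: if_distrib[of "eval_xy _ _"] x y intro!: sum.cong)
      then show "?e (Poly_Mapping.lookup ?L \<pi>) = ?e (coefficient n p (half * (var_x * var_y)) \<pi>)"
        unfolding sum_fibre_card_mult[OF a b p q \<pi>] xy .
    qed
    then show ?thesis using \<pi> R by simp
  qed
qed

lemma phi_A_eq: "phi_A n z = (\<Sum>\<pi>\<in>hyperoctahedral n. Poly_Mapping.single \<pi> (coefficient n 1 z \<pi>))"
  by (simp add: phi_A_def coefficient_def descents_def)

lemma psi_eq: "psi n z = (\<Sum>\<pi>\<in>hyperoctahedral n. Poly_Mapping.single \<pi> (coefficient n 0 z \<pi>))"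
  by (simp add: psi_def coefficient_def descents_def)

theorem theorem2p7p8:
  fixes n :: nat
  assumes "n \<ge> 1"
  shows "phi_A n (half * var_x) * psi n (half * var_y) = phi_A n (half * (var_x * var_y)) \<and>
         psi n (half * var_x) * phi_A n (half * var_y) = psi n (half * (var_x * var_y))"
  using sum_coefficient_mult[OF assms, of 1 0] sum_coefficient_mult[OF assms, of 0 1]
  by (simp add: phi_A_eq psi_eq)

end
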